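(* Let $M\in\mathbb{C}\setminus\{0,1,-1\}$, let $\epsilon\in\{1,-1\}$, let $a,b\in SL(2,\mathbb{C})$, $x=ama^{-1}$, $y=bmb^{-1}$, and $w=x\rhd^{\epsilon}y:=y^{-\epsilon}xy^{\epsilon}$. Then $$w=cmc^{-1}\quad\text{with}\quad c\in SL(2,\mathbb{C}),\quad \tilde c\sim\tilde a\,e^{\epsilon}+\epsilon\,\tilde b\,[\tilde a,\tilde b].$$
   Context: Put $z=M-M^{-1}$, $m=\begin{pmatrix}M&1\\0&M^{-1}\end{pmatrix}$, $e=\begin{pmatrix}M&0\\0&M^{-1}\end{pmatrix}$. For column vectors $u,v\in\mathbb{C}^2$, $\langle u,v\rangle=u_1v_2-u_2v_1$. For $a\in SL(2,\mathbb{C})$ with columns $a_1,a_2$, set $a_3=a_1-za_2$ and $\tilde a=(a_1,a_3)$ (the matrix with columns $a_1,a_3$), which lies in $\tilde{\mathcal D}_M=\{A\in GL(2,\mathbb{C})\mid\det A=-M+M^{-1}\}$. For $P,Q\in\tilde{\mathcal D}_M$, $P\sim Q$ iff $Q=P\begin{pmatrix}t&0\\0&t^{-1}\end{pmatrix}$ for some $t\in\mathbb{C}\setminus\{0\}$. The quandle matrix is $[\tilde a,\tilde b]=\begin{pmatrix}\langle a_1,b_3\rangle&0\\0&\langle a_3,b_1\rangle\end{pmatrix}$. *)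

theory Defs
  imports "HOL-Analysis.Analysis"
begin

type_synonym cvec2 = "complex ^ 2"
type_synonym cmat2 = "complex ^ 2 ^ 2"

(* The operations "*" and "^" on complex ^ 2 ^ 2 are componentwise, so the matrix power
   is built from "**". Negative powers are only meaningful for invertible matrices. *)
definition mat_powi :: "cmat2 \<Rightarrow> int \<Rightarrow> cmat2" where
  "mat_powi A k =
     (if 0 \<le> k then (((**) A) ^^ nat k) (mat 1)
      else (((**) (matrix_inv A)) ^^ nat (- k)) (mat 1))"

definition SL2 :: "cmat2 set" where
  "SL2 = {A. det A = 1}"

definition of_columns :: "cvec2 \<Rightarrow> cvec2 \<Rightarrow> cmat2" where
  "of_columns u v = transpose (vector [u, v])"

definition diag2 :: "complex \<Rightarrow> complex \<Rightarrow> cmat2" where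
  "diag2 s t = vector [vector [s, 0], vector [0, t]]"

definition m_mat :: "complex \<Rightarrow> cmat2" where
  "m_mat M = vector [vector [M, 1], vector [0, inverse M]]"

definition e_mat :: "complex \<Rightarrow> cmat2" where
  "e_mat M = diag2 M (inverse M)"

definition bracket :: "cvec2 \<Rightarrow> cvec2 \<Rightarrow> complex" where
  "bracket u v = u $ 1 * v $ 2 - u $ 2 * v $ 1"

definition third_column :: "complex \<Rightarrow> cmat2 \<Rightarrow> cvec2" where
  "third_column M a = column 1 a - (M - inverse M) *s column 2 a"

definition tilde :: "complex \<Rightarrow> cmat2 \<Rightarrow> cmat2" where
  "tilde M a = of_columns (column 1 a) (third_column M a)"

definition D_tilde :: "complex \<Rightarrow> cmat2 set" where
  "D_tilde M = {A. invertible A \<and> det A = - M + inverse M}"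

definition D_equiv :: "complex \<Rightarrow> cmat2 \<Rightarrow> cmat2 \<Rightarrow> bool" where
  "D_equiv M P Q \<longleftrightarrow>
     P \<in> D_tilde M \<and> Q \<in> D_tilde M \<and> (\<exists>t. t \<noteq> 0 \<and> Q = P ** diag2 t (inverse t))"

(* Stated for arbitrary P, Q: for P = tilde M a and Q = tilde M b, the second columns
   are a_3 and b_3, so the diagonal entries are <a_1, b_3> and <a_3, b_1>. *)
definition quandle_matrix :: "cmat2 \<Rightarrow> cmat2 \<Rightarrow> cmat2" where
  "quandle_matrix P Q =
     diag2 (bracket (column 1 P) (column 2 Q)) (bracket (column 2 P) (column 1 Q))"

definition quandle_op :: "int \<Rightarrow> cmat2 \<Rightarrow> cmat2 \<Rightarrow> cmat2" where
  "quandle_op \<epsilon> x y = mat_powi y (- \<epsilon>) ** x ** mat_powi y \<epsilon>"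

end

theory Submission
  imports Defs
begin

text \<open>
  The columns of \<open>tilde M b\<close> are eigenvectors of \<open>y = b m b\<^sup>-\<^sup>1\<close> for \<open>M\<close> and
  \<open>M\<^sup>-\<^sup>1\<close>. Expanding a vector in this eigenbasis turns the action of \<open>y\<^sup>-\<^sup>1\<close> into
  the transvection-like formulas
  \<open>v \<mapsto> M v + \<langle>v, b\<^sub>3\<rangle> b\<^sub>1\<close> and \<open>v \<mapsto> M\<^sup>-\<^sup>1 v + \<langle>v, b\<^sub>1\<rangle> b\<^sub>3\<close>, and similarly for \<open>y\<close>.
  Applying the first one to \<open>a\<^sub>1\<close> and the second one to \<open>a\<^sub>3\<close> identifies the claimed
  representative with \<open>y\<^sup>-\<^sup>\<epsilon>\<close> times \<open>tilde M a\<close>. So \<open>c = y\<^sup>-\<^sup>\<epsilon> a\<close> works, with scalar \<open>t = 1\<close>.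
\<close>

lemma
  fixes A :: "'a::field ^ 'n ^ 'n"
  assumes "invertible A"
  shows matrix_inv_right: "A ** matrix_inv A = mat 1"
    and matrix_inv_left: "matrix_inv A ** A = mat 1"
  using assms someI_ex [of "\<lambda>B. A ** B = mat 1 \<and> B ** A = mat 1"]
  unfolding invertible_def matrix_inv_def by auto

text \<open>For square matrices a right inverse is two-sided, so one product determines the
  inverse.\<close>

lemma matrix_inv_eqI:
  fixes A B :: "'a::field ^ 'n ^ 'n"
  assumes "A ** B = mat 1"
  shows "matrix_inv A = B"
  by (metis assms invertible_right_inverse matrix_inv_left
      matrix_mul_assoc matrix_mul_lid matrix_mul_rid)

lemma mat_powi_1: "mat_powi A 1 = A"
  by (simp add: mat_powi_def)

lemma mat_powi_minus_1: "mat_powi A (- 1) = matrix_inv A"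
  by (simp add: mat_powi_def)

lemmas cmat2_entries =
  vec_eq_iff forall_2 sum_2 matrix_matrix_mult_def mat_def column_def transpose_def
  of_columns_def diag2_def m_mat_def bracket_def third_column_def tilde_def

lemma column_tilde_1: "column 1 (tilde M a) = column 1 a"
  by (simp add: cmat2_entries)

lemma column_tilde_2: "column 2 (tilde M a) = third_column M a"
  by (simp add: cmat2_entries)

lemma det_tilde: "det (tilde M a) = - (M - inverse M) * det a"
  by (simp add: cmat2_entries det_2) (simp add: algebra_simps)

text \<open>Passing to \<open>tilde M a\<close> is right multiplication of \<open>a\<close> by a
  fixed triangular matrix, so it commutes with left multiplication.\<close>

lemma tilde_mult: "tilde M (A ** a) = A ** tilde M a"
  by (simp add: cmat2_entries) (simp add: algebra_simps)

lemma invertible_SL2: "a \<in> SL2 \<Longrightarrow> invertible a"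
  by (simp add: SL2_def invertible_det_nz)

lemma SL2_mult: "a \<in> SL2 \<Longrightarrow> b \<in> SL2 \<Longrightarrow> a ** b \<in> SL2"
  by (simp add: SL2_def det_mul)

lemma tilde_in_D_tilde:
  assumes "M \<notin> {0, 1, -1}" and "a \<in> SL2"
  shows "tilde M a \<in> D_tilde M"
proof -
  \<comment> \<open>Excluding 1 and -1 makes the eigenvalues \<open>M\<close> and
    \<open>inverse M\<close> distinct, hence \<open>det (tilde M a)\<close> nonzero.\<close>
  have "M * M \<noteq> 1"
    using assms(1) square_eq_1_iff by auto
  then have "M - inverse M \<noteq> 0"
    using assms(1) by (auto simp: field_simps)
  then show ?thesis
    using assms(2) det_tilde [of M a] by (simp add: D_tilde_def SL2_def invertible_det_nz)
qed

lemma matrix_inv_mult: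
  fixes A B :: "'a::field ^ 'n ^ 'n"
  assumes "invertible A" and "invertible B"
  shows "matrix_inv (A ** B) = matrix_inv B ** matrix_inv A"
  by (rule matrix_inv_eqI)
    (metis assms matrix_inv_right matrix_mul_assoc matrix_mul_rid)

lemma matrix_inv_SL2:
  assumes "b \<in> SL2"
  shows "matrix_inv b = vector [vector [b$2$2, - b$1$2], vector [- b$2$1, b$1$1]]"
  using assms
  by (intro matrix_inv_eqI) (simp add: cmat2_entries SL2_def det_2 algebra_simps)

lemma e_mat_inverse:
  assumes "M \<noteq> 0"
  shows "matrix_inv (e_mat M) = diag2 (inverse M) M"
  using assms by (intro matrix_inv_eqI) (simp add: e_mat_def cmat2_entries)

lemma m_mat_inverse:
  assumes "M \<noteq> 0"
  shows "matrix_inv (m_mat M) = vector [vector [inverse M, -1], vector [0, M]]"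
  using assms by (intro matrix_inv_eqI) (simp add: cmat2_entries)

lemma m_mat_in_SL2:
  assumes "M \<noteq> 0"
  shows "m_mat M \<in> SL2"
  using assms by (simp add: SL2_def det_2 m_mat_def)

lemma matrix_inv_in_SL2:
  assumes "a \<in> SL2"
  shows "matrix_inv a \<in> SL2"
  using assms by (simp add: matrix_inv_SL2) (simp add: SL2_def det_2 algebra_simps)

text \<open>The case \<epsilon> = -1, where \<open>y\<close> itself acts; the columns are the images
  of \<open>a_1\<close> and \<open>a_3\<close>.\<close>

lemma conjugate_mult_tilde:
  assumes "M \<noteq> 0" and b: "b \<in> SL2"
  shows "(b ** m_mat M ** matrix_inv b) ** tilde M a =
    tilde M a ** diag2 (inverse M) M - tilde M b ** quandle_matrix (tilde M a) (tilde M b)"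
proof -
  \<comment> \<open>With \<open>N\<close> opaque, every entry is polynomial, and the identities
    follow from \<open>M * N = 1\<close> and \<open>det b = 1\<close> alone.\<close>
  define N where "N = inverse M"
  have "M * N = 1" and "b$1$1 * b$2$2 - b$1$2 * b$2$1 = 1"
    using assms by (simp_all add: N_def SL2_def det_2)
  then show ?thesis
    unfolding matrix_inv_SL2 [OF b] quandle_matrix_def column_tilde_1 column_tilde_2
    by (simp add: cmat2_entries flip: N_def) (intro conjI; algebra)
qed

text \<open>The case \<epsilon> = 1: inverting swaps the eigenvalues of \<open>y\<close>, which
  flips the sign of the correction term.\<close>

lemma inverse_conjugate_mult_tilde:
  assumes "M \<noteq> 0" and b: "b \<in> SL2"
  shows "matrix_inv (b ** m_mat M ** matrix_inv b) ** tilde M a =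
    tilde M a ** e_mat M + tilde M b ** quandle_matrix (tilde M a) (tilde M b)"
proof -
  define N where "N = inverse M"
  have "M * N = 1" and "b$1$1 * b$2$2 - b$1$2 * b$2$1 = 1"
    using assms by (simp_all add: N_def SL2_def det_2)
  moreover have "matrix_inv (b ** m_mat M ** matrix_inv b) =
      b ** matrix_inv (m_mat M) ** matrix_inv b"
    using assms
    by (intro matrix_inv_eqI)
      (metis invertible_SL2 m_mat_in_SL2 matrix_inv_left matrix_inv_right
        matrix_mul_assoc matrix_mul_rid)
  ultimately show ?thesis
    unfolding matrix_inv_SL2 [OF b] m_mat_inverse [OF assms(1)] quandle_matrix_def
      column_tilde_1 column_tilde_2 e_mat_def
    by (simp add: cmat2_entries flip: N_def) (intro conjI; algebra)
qed

theorem proposition2p10: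
  fixes M :: complex and \<epsilon> :: int and a b x y w :: "complex ^ 2 ^ 2"
  assumes "M \<notin> {0, 1, -1}"
    and "\<epsilon> \<in> {1, -1}"
    and "a \<in> SL2" and "b \<in> SL2"
    and "x = a ** m_mat M ** matrix_inv a"
    and "y = b ** m_mat M ** matrix_inv b"
    and "w = quandle_op \<epsilon> x y"
  shows "\<exists>c \<in> SL2. w = c ** m_mat M ** matrix_inv c \<and>
           D_equiv M (tilde M c)
             (tilde M a ** mat_powi (e_mat M) \<epsilon> +
              real_of_int \<epsilon> *\<^sub>R (tilde M b ** quandle_matrix (tilde M a) (tilde M b)))"
proof -
  \<comment> \<open>Since \<open>w\<close> is the conjugate of \<open>x\<close> by \<open>Y\<close>,
    replacing \<open>a\<close> by \<open>Y ** a\<close> conjugates \<open>m_mat M\<close> to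
    \<open>w\<close>.\<close>
  define Y where "Y = mat_powi y (- \<epsilon>)"
  define c where "c = Y ** a"
  have "M \<noteq> 0"
    using assms(1) by simp
  have y: "y \<in> SL2"
    using assms \<open>M \<noteq> 0\<close> by (simp add: SL2_mult m_mat_in_SL2 matrix_inv_in_SL2)
  have "matrix_inv (matrix_inv y) = y"
    using invertible_SL2 [OF y] by (intro matrix_inv_eqI matrix_inv_left)
  then have Y: "Y \<in> SL2" and Y_inv: "matrix_inv Y = mat_powi y \<epsilon>"
    using y assms(2)
    by (auto simp: Y_def mat_powi_1 mat_powi_minus_1 matrix_inv_in_SL2)
  have c: "c \<in> SL2"
    using Y assms(3) by (simp add: c_def SL2_mult)
  have "w = c ** m_mat M ** matrix_inv c"
    using assms(3,5,7) Y
    by (simp add: quandle_op_def c_def matrix_inv_mult invertible_SL2 Y_inv matrix_mul_assoc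
        flip: Y_def)
  moreover have "tilde M c = tilde M a ** mat_powi (e_mat M) \<epsilon> +
      real_of_int \<epsilon> *\<^sub>R (tilde M b ** quandle_matrix (tilde M a) (tilde M b))"
    using assms(2) conjugate_mult_tilde [OF \<open>M \<noteq> 0\<close> assms(4)]
      inverse_conjugate_mult_tilde [OF \<open>M \<noteq> 0\<close> assms(4)]
    by (auto simp: c_def tilde_mult Y_def assms(6) mat_powi_1 mat_powi_minus_1
        e_mat_inverse [OF \<open>M \<noteq> 0\<close>])
  moreover have "D_equiv M (tilde M c) (tilde M c)"
  proof -
    \<comment> \<open>The two sides are equal, so the scalar is 1.\<close>
    have "diag2 1 (inverse 1) = mat 1"
      by (simp add: cmat2_entries)
    then show ?thesis
      using tilde_in_D_tilde [OF assms(1) c] unfolding D_equiv_def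
      by (metis matrix_mul_rid one_neq_zero)
  qed
  ultimately show ?thesis
    using c by metis
qed

end
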